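(* Let $\mathcal{P}$ be a family of probability measures on $\Omega=C([0,\infty);\mathbb{R}^k)$ with upper capacity $c$, and let $X=(X_t)_{t\in[0,\infty)}$ be a process. If $X$ is quasi-continuous on $\Omega\times[0,T]$ (resp. on $\Omega\times[0,\infty)$) and $\tau$ is a quasi-continuous stopping time, then the stopped process $(X_{\tau\wedge t})_{t\in[0,T]}$ (resp. $(X_{\tau\wedge t})_{t\in[0,\infty)}$) is quasi-continuous on $\Omega\times[0,T]$ (resp. on $\Omega\times[0,\infty)$).
   Context: $\Omega=C([0,\infty);\mathbb{R}^k)$ with the (metrizable) topology of locally uniform convergence; $B_t(\omega)=\omega_t$, $\mathcal{F}_t=\sigma\{B_s:s\le t\}$; a stopping time $\tau$ satisfies $\{\tau\le t\}\in\mathcal{F}_t$ for each $t\ge0$. $c(A)=\sup_{P\in\mathcal{P}}P(A)$. A function $\xi:\Omega\to\mathbb{R}$ is quasi-continuous if for each $\varepsilon>0$ there is an open $O\subset\Omega$ with $c(O)<\varepsilon$ such that $\xi|_{O^c}$ is continuous. A process $F$ is quasi-continuous on $\Omega\times[0,T]$ (resp. $\Omega\times[0,\infty)$) if for each $\varepsilon>0$ there is an open $G\subset\Omega$ with $c(G)<\varepsilon$ such that $(\omega,t)\mapsto F_t(\omega)$ is continuous on $G^c\times[0,T]$ (resp. $G^c\times[0,\infty)$). *)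

theory Defs
  imports "HOL-Probability.Probability"
begin

text \<open>The path space \<open>C([0,\<infinity>); \<real>\<^sup>k)\<close>, with \<open>k = CARD('k)\<close>. Extensionality makes two elements equal
  as soon as they agree on \<open>[0,\<infinity>)\<close>; the value of a path at a negative time is irrelevant.\<close>

typedef (overloaded) 'k cpath =
  "{\<omega> :: real \<Rightarrow> real ^ 'k::finite. \<omega> \<in> extensional {0..} \<and> continuous_on {0..} \<omega>}"
  morphisms path_eval Abs_cpath
  by (rule exI[of _ "\<lambda>t\<in>{0..}. 0"]) (auto cong: continuous_on_cong_simp)

text \<open>Canonical process \<open>B\<^sub>t(\<omega>) = \<omega>\<^sub>t\<close>.\<close>

definition canonical_process :: "real \<Rightarrow> 'k::finite cpath \<Rightarrow> real ^ 'k"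
  where "canonical_process t \<omega> = path_eval \<omega> t"

text \<open>Locally uniform convergence: the sets of paths that are uniformly \<open>e\<close>-close to \<open>\<omega>\<close> on \<open>[0,n]\<close>
  form a neighbourhood base at \<open>\<omega>\<close>. See \<open>eventually_nhds_cpath\<close> and \<open>tendsto_cpath_iff\<close> below.\<close>

instantiation cpath :: (finite) topological_space
begin

definition open_cpath :: "'a cpath set \<Rightarrow> bool"
  where "open_cpath U \<longleftrightarrow>
    (\<forall>\<omega>\<in>U. \<exists>n\<ge>0. \<exists>e>0. \<forall>\<omega>'.
      (\<forall>t\<in>{0..n}. dist (canonical_process t \<omega>') (canonical_process t \<omega>) < e) \<longrightarrow> \<omega>' \<in> U)"

instance
proof
  show "open (UNIV :: 'a cpath set)"
    unfolding open_cpath_def by (auto intro: exI[of _ "0::real"] exI[of _ "1::real"])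
next
  fix S T :: "'a cpath set"
  assume S: "open S" and T: "open T"
  show "open (S \<inter> T)"
    unfolding open_cpath_def
  proof
    fix \<omega> assume \<omega>: "\<omega> \<in> S \<inter> T"
    obtain n e where 1: "n \<ge> 0" "e > 0" "\<And>\<omega>'. (\<forall>t\<in>{0..n}. dist (canonical_process t \<omega>')
        (canonical_process t \<omega>) < e) \<Longrightarrow> \<omega>' \<in> S"
      using S \<omega> unfolding open_cpath_def by (meson IntD1)
    obtain m d where 2: "m \<ge> 0" "d > 0" "\<And>\<omega>'. (\<forall>t\<in>{0..m}. dist (canonical_process t \<omega>')
        (canonical_process t \<omega>) < d) \<Longrightarrow> \<omega>' \<in> T"
      using T \<omega> unfolding open_cpath_def by (meson IntD2)
    show "\<exists>n\<ge>0. \<exists>e>0. \<forall>\<omega>'. (\<forall>t\<in>{0..n}. dist (canonical_process t \<omega>')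
        (canonical_process t \<omega>) < e) \<longrightarrow> \<omega>' \<in> S \<inter> T"
      using 1 2
      by (intro exI[of _ "max n m"] exI[of _ "min e d"] conjI allI impI IntI 1(3) 2(3)) auto
  qed
next
  fix K :: "'a cpath set set"
  assume "\<forall>S\<in>K. open S"
  then show "open (\<Union>K)"
    unfolding open_cpath_def by (meson Union_iff)
qed

end

lemma continuous_on_canonical_process:
  "continuous_on {0..} (\<lambda>t. canonical_process t \<omega>)"
  using path_eval[of \<omega>] by (simp add: canonical_process_def)

lemma open_cpath_ball:
  fixes \<omega>\<^sub>0 :: "'k::finite cpath"
  assumes "n \<ge> 0"
  shows "open {\<omega>. \<forall>t\<in>{0..n}. dist (canonical_process t \<omega>) (canonical_process t \<omega>\<^sub>0) < e}"
  unfolding open_cpath_def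
proof
  fix \<omega> assume \<omega>: "\<omega> \<in> {\<omega>. \<forall>t\<in>{0..n}. dist (canonical_process t \<omega>) (canonical_process t \<omega>\<^sub>0) < e}"
  let ?f = "\<lambda>t. dist (canonical_process t \<omega>) (canonical_process t \<omega>\<^sub>0)"
  have "continuous_on {0..n} ?f"
    by (intro continuous_on_dist continuous_on_subset[OF continuous_on_canonical_process]) auto
  then obtain s where s: "s \<in> {0..n}" "\<And>t. t \<in> {0..n} \<Longrightarrow> ?f t \<le> ?f s"
    using continuous_attains_sup[of "{0..n}" ?f] assms by auto
  have "\<omega>' \<in> {\<omega>. \<forall>t\<in>{0..n}. dist (canonical_process t \<omega>) (canonical_process t \<omega>\<^sub>0) < e}"
    if "\<forall>t\<in>{0..n}. dist (canonical_process t \<omega>') (canonical_process t \<omega>) < e - ?f s" for \<omega>'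
  proof (intro CollectI ballI)
    fix t assume t: "t \<in> {0..n}"
    show "dist (canonical_process t \<omega>') (canonical_process t \<omega>\<^sub>0) < e"
      using that[rule_format, OF t] s(2)[OF t]
        dist_triangle[of "canonical_process t \<omega>'" "canonical_process t \<omega>\<^sub>0" "canonical_process t \<omega>"]
      by linarith
  qed
  moreover have "e - ?f s > 0" using \<omega> s(1) by auto
  ultimately show "\<exists>n'\<ge>0. \<exists>d>0. \<forall>\<omega>'.
      (\<forall>t\<in>{0..n'}. dist (canonical_process t \<omega>') (canonical_process t \<omega>) < d) \<longrightarrow>
      \<omega>' \<in> {\<omega>. \<forall>t\<in>{0..n}. dist (canonical_process t \<omega>) (canonical_process t \<omega>\<^sub>0) < e}"
    using assms by blast
qed

lemma eventually_nhds_cpath: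
  fixes \<omega> :: "'k::finite cpath"
  shows "eventually P (nhds \<omega>) \<longleftrightarrow>
    (\<exists>n\<ge>0. \<exists>e>0. \<forall>\<omega>'.
      (\<forall>t\<in>{0..n}. dist (canonical_process t \<omega>') (canonical_process t \<omega>) < e) \<longrightarrow> P \<omega>')"
proof
  assume "eventually P (nhds \<omega>)"
  then show "\<exists>n\<ge>0. \<exists>e>0. \<forall>\<omega>'.
      (\<forall>t\<in>{0..n}. dist (canonical_process t \<omega>') (canonical_process t \<omega>) < e) \<longrightarrow> P \<omega>'"
    unfolding eventually_nhds open_cpath_def by meson
next
  assume "\<exists>n\<ge>0. \<exists>e>0. \<forall>\<omega>'.
      (\<forall>t\<in>{0..n}. dist (canonical_process t \<omega>') (canonical_process t \<omega>) < e) \<longrightarrow> P \<omega>'"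
  then obtain n e where "n \<ge> 0" "e > 0" and P: "\<And>\<omega>'.
      \<forall>t\<in>{0..n}. dist (canonical_process t \<omega>') (canonical_process t \<omega>) < e \<Longrightarrow> P \<omega>'"
    by blast
  then show "eventually P (nhds \<omega>)"
    unfolding eventually_nhds
    by (intro exI[of _ "{\<omega>'. \<forall>t\<in>{0..n}. dist (canonical_process t \<omega>') (canonical_process t \<omega>) < e}"])
      (auto intro: open_cpath_ball)
qed

lemma tendsto_cpath_iff:
  fixes f :: "'a \<Rightarrow> 'k::finite cpath"
  shows "(f \<longlongrightarrow> \<omega>) F \<longleftrightarrow>
    (\<forall>n. uniform_limit {0..n} (\<lambda>x t. canonical_process t (f x)) (\<lambda>t. canonical_process t \<omega>) F)"
proof
  assume L: "(f \<longlongrightarrow> \<omega>) F"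
  show "\<forall>n. uniform_limit {0..n} (\<lambda>x t. canonical_process t (f x)) (\<lambda>t. canonical_process t \<omega>) F"
  proof (intro allI uniform_limitI)
    fix n e :: real assume "e > 0"
    show "\<forall>\<^sub>F x in F. \<forall>t\<in>{0..n}. dist (canonical_process t (f x)) (canonical_process t \<omega>) < e"
    proof (cases "n \<ge> 0")
      case True
      then have "\<forall>\<^sub>F \<omega>' in nhds \<omega>. \<forall>t\<in>{0..n}. dist (canonical_process t \<omega>') (canonical_process t \<omega>) < e"
        using \<open>e > 0\<close> unfolding eventually_nhds_cpath by blast
      then show ?thesis
        using L by (rule eventually_compose_filterlim)
    qed auto
  qed
next
  assume L: "\<forall>n. uniform_limit {0..n} (\<lambda>x t. canonical_process t (f x)) (\<lambda>t. canonical_process t \<omega>) F"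
  show "(f \<longlongrightarrow> \<omega>) F"
    unfolding filterlim_iff eventually_nhds_cpath
  proof (intro allI impI, elim exE conjE)
    fix P and n e :: real
    assume "e > 0" and P: "\<forall>\<omega>'. (\<forall>t\<in>{0..n}. dist (canonical_process t \<omega>') (canonical_process t \<omega>) < e)
      \<longrightarrow> P \<omega>'"
    then show "\<forall>\<^sub>F x in F. P (f x)"
      using uniform_limitD[OF L[rule_format, of n] \<open>e > 0\<close>] by (auto elim: eventually_mono)
  qed
qed

text \<open>\<open>\<F>\<^sub>t = \<sigma>{B\<^sub>s : s \<le> t}\<close>. For \<open>t < 0\<close> this is the trivial \<open>\<sigma>\<close>-algebra, so for a nonnegative \<open>\<tau>\<close>
  the library's \<open>stopping_time canonical_filtration \<tau>\<close>, which quantifies over all real \<open>t\<close>,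
  only constrains \<open>t \<ge> 0\<close>.\<close>

definition canonical_filtration :: "real \<Rightarrow> 'k::finite cpath measure"
  where "canonical_filtration t =
    sigma UNIV {canonical_process s -` A | s A. 0 \<le> s \<and> s \<le> t \<and> A \<in> sets borel}"

lemma stopping_time_canonical_filtration_iff:
  fixes \<tau> :: "'k::finite cpath \<Rightarrow> real"
  assumes "\<And>\<omega>. 0 \<le> \<tau> \<omega>"
  shows "stopping_time canonical_filtration \<tau> \<longleftrightarrow>
    (\<forall>t\<ge>0. {\<omega>. \<tau> \<omega> \<le> t} \<in> sets (canonical_filtration t))"
proof -
  have [simp]: "space (canonical_filtration t) = (UNIV :: 'k cpath set)" for t
    by (simp add: canonical_filtration_def space_measure_of_conv)
  have "{\<omega>. \<tau> \<omega> \<le> t} = {}" if "t < 0" for t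
    using assms that by (metis (no_types, lifting) Collect_empty_eq leD order.trans)
  then have "{\<omega>. \<tau> \<omega> \<le> t} \<in> sets (canonical_filtration t)" if "t < 0" for t
    using that by simp
  then show ?thesis
    by (auto simp: stopping_time_def pred_def) (meson not_le)
qed

definition upper_capacity :: "'a measure set \<Rightarrow> 'a set \<Rightarrow> ennreal"
  where "upper_capacity \<P> A = (SUP P\<in>\<P>. emeasure P A)"

definition quasi_continuous :: "'a::topological_space measure set \<Rightarrow> ('a \<Rightarrow> real) \<Rightarrow> bool"
  where "quasi_continuous \<P> \<xi> \<longleftrightarrow>
    (\<forall>\<epsilon>>0. \<exists>U. open U \<and> upper_capacity \<P> U < ennreal \<epsilon> \<and> continuous_on (- U) \<xi>)"

text \<open>Quasi-continuity of a process on \<open>\<Omega> \<times> I\<close>; the relevant index sets \<open>I\<close> are \<open>[0,T]\<close>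
  and \<open>[0,\<infinity>)\<close>.\<close>

definition quasi_continuous_process ::
    "'a::topological_space measure set \<Rightarrow> real set \<Rightarrow> (real \<Rightarrow> 'a \<Rightarrow> real) \<Rightarrow> bool"
  where "quasi_continuous_process \<P> I F \<longleftrightarrow>
    (\<forall>\<epsilon>>0. \<exists>G. open G \<and> upper_capacity \<P> G < ennreal \<epsilon> \<and>
      continuous_on ((- G) \<times> I) (\<lambda>(\<omega>, t). F t \<omega>))"

definition stopped_process :: "('a \<Rightarrow> real) \<Rightarrow> (real \<Rightarrow> 'a \<Rightarrow> real) \<Rightarrow> real \<Rightarrow> 'a \<Rightarrow> real"
  where "stopped_process \<tau> X t \<omega> = X (min (\<tau> \<omega>) t) \<omega>"

end

theory Submission
  imports Defs
begin

text \<open>The stopped process is \<open>X\<close> composed with the map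
  \<open>(\<omega>, t) \<mapsto> (\<omega>, min (\<tau> \<omega>) t)\<close>. Wherever \<tau> is
  continuous in \<omega>, this map is jointly continuous, and it stays inside the index set, so the
  composition is continuous wherever \<open>X\<close> is jointly continuous as well
  (\<open>continuous_on_stopped_process\<close>). Given \<epsilon>, remove one open set of capacity
  below \<epsilon>/2 for \<tau> and another for \<open>X\<close>. Their union is open, and its
  capacity is below \<epsilon> because a supremum of measures is subadditive
  (\<open>upper_capacity_Un_le\<close>).\<close>

lemma upper_capacity_Un_le:
  assumes "\<And>P. P \<in> \<P> \<Longrightarrow> A \<in> sets P" and "\<And>P. P \<in> \<P> \<Longrightarrow> B \<in> sets P"
  shows "upper_capacity \<P> (A \<union> B) \<le> upper_capacity \<P> A + upper_capacity \<P> B"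
  unfolding upper_capacity_def
proof (rule SUP_least)
  fix P assume P: "P \<in> \<P>"
  have "emeasure P (A \<union> B) \<le> emeasure P A + emeasure P B"
    using assms P by (intro emeasure_subadditive) auto
  also have "\<dots> \<le> (SUP P\<in>\<P>. emeasure P A) + (SUP P\<in>\<P>. emeasure P B)"
    using P by (intro add_mono SUP_upper)
  finally show "emeasure P (A \<union> B) \<le> (SUP P\<in>\<P>. emeasure P A) + (SUP P\<in>\<P>. emeasure P B)" .
qed

text \<open>The deterministic core: a composition of continuous maps. Assumption \<open>I\<close>
  says that the inner map sends \<open>S \<times> I\<close> into itself, so continuity of
  \<open>X\<close> on that product alone suffices.\<close>

lemma continuous_on_stopped_process:
  fixes \<tau> :: "'a::topological_space \<Rightarrow> real" and X :: "real \<Rightarrow> 'a \<Rightarrow> real"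
  assumes "continuous_on S \<tau>" and X: "continuous_on (S \<times> I) (\<lambda>(\<omega>, t). X t \<omega>)"
    and I: "\<And>\<omega> t. \<omega> \<in> S \<Longrightarrow> t \<in> I \<Longrightarrow> min (\<tau> \<omega>) t \<in> I"
  shows "continuous_on (S \<times> I) (\<lambda>(\<omega>, t). stopped_process \<tau> X t \<omega>)"
proof -
  have "continuous_on (S \<times> I) (\<lambda>p. \<tau> (fst p))"
    by (rule continuous_on_compose2[OF assms(1)]) (auto intro: continuous_intros)
  then have "continuous_on (S \<times> I) (\<lambda>p. (fst p, min (\<tau> (fst p)) (snd p)))"
    by (intro continuous_intros)
  then have "continuous_on (S \<times> I)
      (\<lambda>p. (\<lambda>(\<omega>, t). X t \<omega>) (fst p, min (\<tau> (fst p)) (snd p)))"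
    by (rule continuous_on_compose2[OF X]) (auto intro: I)
  then show ?thesis
    by (simp add: stopped_process_def case_prod_unfold)
qed

text \<open>Keeping the index set abstract treats bounded and unbounded time at once; only its
  closure under \<open>min (\<tau> \<omega>)\<close> matters.\<close>

lemma quasi_continuous_process_stopped:
  fixes \<P> :: "'a::topological_space measure set"
  assumes sets: "\<And>P. P \<in> \<P> \<Longrightarrow> sets P = sets borel"
    and \<tau>: "quasi_continuous \<P> \<tau>" and X: "quasi_continuous_process \<P> I X"
    and I: "\<And>\<omega> t. t \<in> I \<Longrightarrow> min (\<tau> \<omega>) t \<in> I"
  shows "quasi_continuous_process \<P> I (stopped_process \<tau> X)"
  unfolding quasi_continuous_process_def
proof (intro allI impI)
  fix \<epsilon> :: real assume "\<epsilon> > 0"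
  then have \<epsilon>: "\<epsilon> / 2 > 0" by simp
  obtain U where U: "open U" "upper_capacity \<P> U < ennreal (\<epsilon> / 2)" "continuous_on (- U) \<tau>"
    using \<tau> \<epsilon> unfolding quasi_continuous_def by blast
  obtain G where G: "open G" "upper_capacity \<P> G < ennreal (\<epsilon> / 2)"
      "continuous_on ((- G) \<times> I) (\<lambda>(\<omega>, t). X t \<omega>)"
    using X \<epsilon> unfolding quasi_continuous_process_def by blast
  have "upper_capacity \<P> (U \<union> G) \<le> upper_capacity \<P> U + upper_capacity \<P> G"
    \<comment> \<open>Subadditivity needs both sets measurable for every \<open>P\<close> in the
      family; open sets are, since each \<open>P\<close> lives on the Borel sets.\<close>
    using U(1) G(1) by (intro upper_capacity_Un_le) (auto simp: sets)
  also have "\<dots> < ennreal (\<epsilon> / 2) + ennreal (\<epsilon> / 2)"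
    using U(2) G(2) by (rule add_strict_mono)
  also have "\<dots> = ennreal \<epsilon>"
    using \<epsilon> by (simp flip: ennreal_plus)
  finally have "upper_capacity \<P> (U \<union> G) < ennreal \<epsilon>" .
  \<comment> \<open>Off the union both good sets are available, so each continuity statement
    restricts to it.\<close>
  moreover have "continuous_on ((- (U \<union> G)) \<times> I) (\<lambda>(\<omega>, t). stopped_process \<tau> X t \<omega>)"
    by (intro continuous_on_stopped_process I continuous_on_subset[OF U(3)]
        continuous_on_subset[OF G(3)]) auto
  ultimately show "\<exists>G. open G \<and> upper_capacity \<P> G < ennreal \<epsilon> \<and>
      continuous_on ((- G) \<times> I) (\<lambda>(\<omega>, t). stopped_process \<tau> X t \<omega>)"
    using U(1) G(1) by blast
qed

theorem proposition4p5:
  fixes \<P> :: "'k::finite cpath measure set"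
    and X :: "real \<Rightarrow> 'k cpath \<Rightarrow> real"
    and \<tau> :: "'k cpath \<Rightarrow> real"
  assumes "\<And>P. P \<in> \<P> \<Longrightarrow> prob_space P"
    and "\<And>P. P \<in> \<P> \<Longrightarrow> sets P = sets borel"
    and "\<And>\<omega>. 0 \<le> \<tau> \<omega>"
    and "stopping_time canonical_filtration \<tau>"
    and "quasi_continuous \<P> \<tau>"
  shows "(\<forall>T\<ge>0. quasi_continuous_process \<P> {0..T} X \<longrightarrow>
            quasi_continuous_process \<P> {0..T} (stopped_process \<tau> X)) \<and>
         (quasi_continuous_process \<P> {0..} X \<longrightarrow>
            quasi_continuous_process \<P> {0..} (stopped_process \<tau> X))"
proof (intro conjI allI impI)
  show "quasi_continuous_process \<P> {0..T} (stopped_process \<tau> X)"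
    if "quasi_continuous_process \<P> {0..T} X" for T
    using assms(2,5) that
    \<comment> \<open>The minimum is at least 0 because \<tau> is nonnegative, and at most
      \<open>T\<close> because it is bounded by \<open>t\<close>.\<close>
    by (rule quasi_continuous_process_stopped) (auto simp: assms(3) min.coboundedI2)
  show "quasi_continuous_process \<P> {0..} (stopped_process \<tau> X)"
    if "quasi_continuous_process \<P> {0..} X"
    using assms(2,5) that
    by (rule quasi_continuous_process_stopped) (auto simp: assms(3))
qed

end
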